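(* Let $f:\mathbb R_+\to\mathbb C$ be locally absolutely continuous, of bounded variation, and such that $\lim_{t\to\infty}f(t)=0$. Then the cosine Fourier transform of $f$, $$\widehat{f_c}(x)=\int_0^\infty f(t)\cos xt\,dt ,$$ is Lebesgue integrable on $\mathbb R_+$ if and only if $f'\in Q_0$.
   Context: Here $\mathbb R_+=[0,\infty)$. The integral defining $\widehat{f_c}(x)$ is understood, for $x>0$, as the improper integral $\lim_{A\to\infty}\int_0^A$. For an integrable function $g$ on $\mathbb R_+$, the sine Fourier transform is $\widehat{g_s}(x)=\int_0^\infty g(t)\sin xt\,dt$. The space $Q_0$ is $$Q_0=\Big\{g:\ g\in L^1(\mathbb R),\ g(-t)=-g(t),\ \int_0^\infty\frac{|\widehat{g_s}(x)|}{x}\,dx<\infty\Big\}.$$ A function defined (almost everywhere) on $\mathbb R_+$, such as $f'$, is said to belong to $Q_0$ if its odd extension to $\mathbb R$ does. *)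

theory Defs
  imports "HOL-Analysis.Analysis"
begin

text \<open>
  In the next three definitions \<open>S\<close> is meant to be an interval. The members of a division are
  pairwise non-overlapping compact intervals \<open>K = {Inf K..Sup K}\<close>. Degenerate members
  \<open>{a..a}\<close> are allowed but contribute nothing to any of the sums.
\<close>

definition absolutely_continuous_on :: "real set \<Rightarrow> (real \<Rightarrow> 'a::real_normed_vector) \<Rightarrow> bool" where
  "absolutely_continuous_on S f \<longleftrightarrow>
     (\<forall>\<epsilon>>0. \<exists>\<delta>>0. \<forall>D T. D division_of T \<and> T \<subseteq> S \<and> (\<Sum>K\<in>D. Sup K - Inf K) < \<delta> \<longrightarrow>
        (\<Sum>K\<in>D. norm (f (Sup K) - f (Inf K))) < \<epsilon>)"

definition locally_absolutely_continuous_on ::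
    "real set \<Rightarrow> (real \<Rightarrow> 'a::real_normed_vector) \<Rightarrow> bool" where
  "locally_absolutely_continuous_on S f \<longleftrightarrow>
     (\<forall>a b. {a..b} \<subseteq> S \<longrightarrow> absolutely_continuous_on {a..b} f)"

definition bounded_variation_on :: "real set \<Rightarrow> (real \<Rightarrow> 'a::real_normed_vector) \<Rightarrow> bool" where
  "bounded_variation_on S f \<longleftrightarrow>
     (\<exists>V. \<forall>a b D. {a..b} \<subseteq> S \<and> D division_of {a..b} \<longrightarrow>
        (\<Sum>K\<in>D. norm (f (Sup K) - f (Inf K))) \<le> V)"

text \<open>
  The improper integral over \<open>{0..}\<close>. If \<open>f\<close> has bounded variation and tends to \<open>0\<close>, the limit
  exists for every \<open>x > 0\<close>. At the single point \<open>x = 0\<close> it may fail to exist, in which case the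
  value is unspecified; this is irrelevant to Lebesgue integrability in \<open>x\<close>.
\<close>

definition cosine_transform :: "(real \<Rightarrow> complex) \<Rightarrow> real \<Rightarrow> complex" where
  "cosine_transform f x =
     Lim at_top (\<lambda>A. LINT t:{0..A}|lebesgue. f t * complex_of_real (cos (x * t)))"

definition sine_transform :: "(real \<Rightarrow> complex) \<Rightarrow> real \<Rightarrow> complex" where
  "sine_transform g x = (LINT t:{0..}|lebesgue. g t * complex_of_real (sin (x * t)))"

definition Q0 :: "(real \<Rightarrow> complex) set" where
  "Q0 = {g. integrable lebesgue g \<and> (\<forall>t. g (- t) = - g t) \<and>
            (\<integral>\<^sup>+x\<in>{0<..}. ennreal (norm (sine_transform g x) / x) \<partial>lebesgue) < \<infinity>}"

text \<open>Only the values of \<open>g\<close> on the open half-line enter the odd extension.\<close>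

definition odd_extension :: "(real \<Rightarrow> complex) \<Rightarrow> real \<Rightarrow> complex" where
  "odd_extension g t = (if t > 0 then g t else if t < 0 then - g (- t) else 0)"

text \<open>
  For a function defined almost everywhere on \<open>{0..}\<close>. It may be represented by any total
  function that agrees with it almost everywhere there: since \<^term>\<open>lebesgue\<close> is complete, the
  values on a null set do not affect membership.
\<close>

definition belongs_to_Q0 :: "(real \<Rightarrow> complex) \<Rightarrow> bool" where
  "belongs_to_Q0 g \<longleftrightarrow> odd_extension g \<in> Q0"

end

theory Submission
  imports Defs
begin

text \<open>
  Integrating by parts and letting the upper limit tend to infinity gives
  \<open>cosine_transform f x = - sine_transform f' x / x\<close> for \<open>x > 0\<close>, so integrability of the left-hand
  side is the integral condition in \<^const>\<open>Q0\<close>. The substance is the fundamental theorem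
  of calculus for \<open>f\<close>: its total variation \<open>V\<close> is absolutely continuous and bounded, hence the
  Stieltjes measures of \<open>V\<close>, \<open>V + Re f\<close> and \<open>V + Im f\<close> are finite and absolutely continuous, and
  Radon-Nikodym yields an integrable \<open>g\<close> with \<open>f x - f 0\<close> equal to the integral of \<open>g\<close> over
  \<open>{0..x}\<close>. Lebesgue differentiation then identifies \<open>g\<close> with \<open>f'\<close> almost everywhere.
\<close>

section \<open>Divisions and total variation\<close>

lemma division_real_cases:
  fixes D :: "real set set"
  assumes "D division_of T" "K \<in> D"
  obtains a b where "a \<le> b" "K = {a..b}" "Inf K = a" "Sup K = b"
proof -
  obtain a b where K: "K = cbox a b" "K \<noteq> {}"
    using division_ofD(3,4)[OF assms] by blast
  then show ?thesis by (intro that[of a b]) auto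
qed

text \<open>Distinct members meet in a convex set with empty interior, hence in a negligible one.
  The total length thus depends only on \<open>T\<close>, so refining a division keeps it below the
  same \<delta>.\<close>

lemma sum_length_division:
  fixes D :: "real set set"
  assumes "D division_of T"
  shows "(\<Sum>K\<in>D. Sup K - Inf K) = measure lebesgue T"
proof -
  have "measure lebesgue (\<Union>D) = (\<Sum>K\<in>D. measure lebesgue K)"
  proof (rule measure_negligible_finite_Union)
    show "finite D" using assms by auto
    show "K \<in> lmeasurable" if "K \<in> D" for K
      using division_real_cases[OF assms that] by (metis cbox_interval lmeasurable_cbox)
    show "pairwise (\<lambda>S T. negligible (S \<inter> T)) D"
    proof (rule pairwiseI)
      fix K L assume KL: "K \<in> D" "L \<in> D" "K \<noteq> L"
      obtain a b where 1: "K = {a..b}" using division_real_cases[OF assms KL(1)] by metis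
      obtain c d where 2: "L = {c..d}" using division_real_cases[OF assms KL(2)] by metis
      have "interior (K \<inter> L) = {}"
        using division_ofD(5)[OF assms KL] by simp
      then show "negligible (K \<inter> L)"
        by (simp add: 1 2 negligible_convex_interior)
    qed
  qed
  also have "\<dots> = (\<Sum>K\<in>D. Sup K - Inf K)"
  proof (rule sum.cong)
    fix K assume "K \<in> D"
    obtain a b where "a \<le> b" "K = {a..b}" "Inf K = a" "Sup K = b"
      using division_real_cases[OF assms \<open>K \<in> D\<close>] by metis
    then show "measure lebesgue K = Sup K - Inf K" by simp
  qed simp
  finally show ?thesis using assms by auto
qed

text \<open>An interval that belongs to the refinements of two different members has empty interior
  and so is a single point. It is counted once in the union but repeatedly in the iterated sum; the
  condition on \<open>h {a..a}\<close> makes this harmless.\<close>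

lemma sum_UNION_division:
  fixes p :: "real set \<Rightarrow> real set set"
  assumes "D division_of T" and p: "\<And>K. K \<in> D \<Longrightarrow> p K division_of K"
    and h: "\<And>a. h {a..a} = (0::real)"
  shows "(\<Union>K\<in>D. p K) division_of T"
    and "(\<Sum>L\<in>(\<Union>K\<in>D. p K). h L) = (\<Sum>K\<in>D. \<Sum>L\<in>p K. h L)"
proof -
  have fin: "finite D" using assms(1) by auto
  have sub: "L \<subseteq> K" if "K \<in> D" "L \<in> p K" for K L
    using p[OF that(1)] that(2) by auto
  show "(\<Union>K\<in>D. p K) division_of T"
  proof (rule division_ofI)
    show "finite (\<Union>K\<in>D. p K)" using fin p by auto
    fix L assume "L \<in> (\<Union>K\<in>D. p K)"
    then obtain K where K: "K \<in> D" "L \<in> p K" by auto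
    show "L \<subseteq> T" using sub[OF K] assms(1) K by (meson division_ofD(2) order_trans)
    show "L \<noteq> {}" "\<exists>a b. L = cbox a b"
      using division_ofD(3,4)[OF p] K by auto
    fix L' assume "L' \<in> (\<Union>K\<in>D. p K)" and ne: "L \<noteq> L'"
    then obtain K' where K': "K' \<in> D" "L' \<in> p K'" by auto
    show "interior L \<inter> interior L' = {}"
    proof (cases "K = K'")
      case True
      then show ?thesis using division_ofD(5)[OF p[OF K(1)]] K K' ne by auto
    next
      case False
      then have "interior K \<inter> interior K' = {}"
        using division_ofD(5)[OF assms(1)] K K' by auto
      then show ?thesis using interior_mono[OF sub[OF K]] interior_mono[OF sub[OF K']] by auto
    qed
  next
    have "\<Union>(p K) = K" if "K \<in> D" for K using p[OF that] by auto
    then have "\<Union>(\<Union>K\<in>D. p K) = \<Union>D" by blast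
    then show "\<Union>(\<Union>K\<in>D. p K) = T" using assms(1) by auto
  qed
  \<comment> \<open>A division determines the set that it divides, so \<open>p K\<close> determines
    \<open>K\<close>.\<close>
  have inj: "inj_on p D"
    by (rule inj_onI) (metis division_ofD(6) p)
  have "(\<Sum>L\<in>\<Union>(p ` D). h L) = (sum \<circ> sum) h (p ` D)"
  proof (rule sum.Union_comp)
    show "\<forall>A\<in>p ` D. finite A" using p by auto
    fix A B L assume "A \<in> p ` D" "B \<in> p ` D" "A \<noteq> B" and L: "L \<in> A" "L \<in> B"
    then obtain K K' where K: "K \<in> D" "K' \<in> D" "K \<noteq> K'" "A = p K" "B = p K'" by auto
    have "interior K \<inter> interior K' = {}"
      using division_ofD(5)[OF assms(1)] K by auto
    then have int: "interior L = {}"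
      using interior_mono[OF sub[of K L]] interior_mono[OF sub[of K' L]] K L by auto
    obtain a b where ab: "a \<le> b" "L = {a..b}"
      using division_real_cases[OF p[OF K(1)]] L K by metis
    with int have "a = b" by simp
    then show "h L = 0" using h ab by simp
  qed
  then show "(\<Sum>L\<in>(\<Union>K\<in>D. p K). h L) = (\<Sum>K\<in>D. \<Sum>L\<in>p K. h L)"
    by (simp add: sum.reindex[OF inj])
qed

section \<open>Total variation on compact intervals\<close>

definition division_variation :: "(real \<Rightarrow> 'a::real_normed_vector) \<Rightarrow> real set set \<Rightarrow> real" where
  "division_variation f D = (\<Sum>K\<in>D. norm (f (Sup K) - f (Inf K)))"

text \<open>On the reals \<open>SUP\<close> is a true least upper bound only for a nonempty family
  that is bounded above. \<open>bdd_division_variation\<close> supplies the bound, and for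
  \<open>a \<le> b\<close> the division \<open>{{a..b}}\<close> shows nonemptiness.\<close>

definition variation :: "(real \<Rightarrow> 'a::real_normed_vector) \<Rightarrow> real \<Rightarrow> real \<Rightarrow> real" where
  "variation f a b = (SUP D \<in> {D. D division_of {a..b}}. division_variation f D)"

text \<open>A common member lies in \<open>{b}\<close>, so it is degenerate and contributes zero,
  whether it is counted once or twice.\<close>

lemma division_variation_Un:
  assumes "D1 division_of {a..b}" "D2 division_of {b..c}" "a \<le> b" "b \<le> c"
  shows "(D1 \<union> D2) division_of {a..c}"
    and "division_variation f (D1 \<union> D2) = division_variation f D1 + division_variation f D2"
proof -
  have "{a..b} \<union> {b..c} = {a..c}" using assms by auto
  then show "(D1 \<union> D2) division_of {a..c}"
    using division_disjoint_union[OF assms(1,2)] by (auto simp: disjoint_iff)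
  have "norm (f (Sup K) - f (Inf K)) = 0" if "K \<in> D1 \<inter> D2" for K
  proof -
    have "K \<subseteq> {a..b}" "K \<subseteq> {b..c}" "K \<noteq> {}"
      using that division_ofD(2,3)[OF assms(1)] division_ofD(2)[OF assms(2)] by auto
    then have "K \<subseteq> {b}" by fastforce
    then have "K = {b}" using \<open>K \<noteq> {}\<close> by auto
    then show ?thesis by simp
  qed
  then show "division_variation f (D1 \<union> D2) = division_variation f D1 + division_variation f D2"
    unfolding division_variation_def
    by (intro sum.union_inter_neutral) (use assms in auto)
qed

text \<open>Every interval is cut at \<open>b\<close>. If \<open>b\<close> is interior to it, the
  triangle inequality shows that the two pieces contribute at least as much as the whole.\<close>

lemma division_variation_split:
  assumes D: "D division_of {a..c}" and "a \<le> b" "b \<le> c"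
  obtains D1 D2 where "D1 division_of {a..b}" "D2 division_of {b..c}"
    "division_variation f D \<le> division_variation f D1 + division_variation f D2"
proof -
  \<comment> \<open>The empty set gets the value 0 explicitly, as \<open>Sup {}\<close> and
    \<open>Inf {}\<close> carry no information. Sums can then run over all of \<open>D\<close>,
    including members that miss one side.\<close>
  define h where "h K = (if K = {} then 0 else norm (f (Sup K) - f (Inf K)))" for K
  define D1 where "D1 = {K \<inter> {..b} |K. K \<in> D \<and> K \<inter> {..b} \<noteq> {}}"
  define D2 where "D2 = {K \<inter> {b..} |K. K \<in> D \<and> K \<inter> {b..} \<noteq> {}}"
  have sets: "{x::real. x \<bullet> 1 \<le> b} = {..b}" "{x::real. x \<bullet> 1 \<ge> b} = {b..}" by auto
  have fin: "finite D" using D by auto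
  have ab: "{a..c} \<inter> {..b} = {a..b}" "{a..c} \<inter> {b..} = {b..c}" using assms by auto
  have D': "D division_of cbox a c" using D by simp
  have d1: "D1 division_of {a..b}"
    using division_split(1)[OF D', of 1 b] unfolding D1_def sets cbox_interval ab by simp
  have d2: "D2 division_of {b..c}"
    using division_split(2)[OF D', of 1 b] unfolding D2_def sets cbox_interval ab by simp
  \<comment> \<open>Two members can have the same trace on a half-line only if that trace has empty
    interior, hence is empty or a single point. As \<open>h\<close> vanishes there, reindexing the
    sum by traces loses nothing.\<close>
  have hz: "h (K \<inter> S) = 0" if K: "K \<in> D" and S: "S = {..b} \<or> S = {b..}" and int: "interior (K \<inter> S) = {}" for K S
  proof -
    obtain u v where uv: "u \<le> v" "K = {u..v}"
      using division_real_cases[OF D K] by metis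
    have "{u..v} \<inter> {..b} = {u..min v b}" "{u..v} \<inter> {b..} = {max u b..v}" by auto
    then have "\<exists>p q. K \<inter> S = {p..q}" using S unfolding uv by metis
    then obtain p q where "K \<inter> S = {p..q}" by metis
    with int show ?thesis by (cases "p = q") (auto simp: h_def)
  qed
  have s1: "(\<Sum>K\<in>D. h (K \<inter> {..b})) = division_variation f D1"
  proof -
    have "division_variation f D1 = (\<Sum>K\<in>(\<lambda>K. K \<inter> {..b}) ` D. h K)"
      unfolding division_variation_def
      by (rule sum.mono_neutral_cong_left) (use fin in \<open>auto simp: D1_def h_def\<close>)
    also have "\<dots> = (\<Sum>K\<in>D. h (K \<inter> {..b}))"
      using sum.reindex_nontrivial[OF fin, of "\<lambda>K. K \<inter> {..b}" h]
        division_split_left_inj[OF D, where k=1 and c=b] hz unfolding sets o_def by metis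
    finally show ?thesis by simp
  qed
  have s2: "(\<Sum>K\<in>D. h (K \<inter> {b..})) = division_variation f D2"
  proof -
    have "division_variation f D2 = (\<Sum>K\<in>(\<lambda>K. K \<inter> {b..}) ` D. h K)"
      unfolding division_variation_def
      by (rule sum.mono_neutral_cong_left) (use fin in \<open>auto simp: D2_def h_def\<close>)
    also have "\<dots> = (\<Sum>K\<in>D. h (K \<inter> {b..}))"
      using sum.reindex_nontrivial[OF fin, of "\<lambda>K. K \<inter> {b..}" h]
        division_split_right_inj[OF D, where k=1 and c=b] hz unfolding sets o_def by metis
    finally show ?thesis by simp
  qed
  have "division_variation f D \<le> (\<Sum>K\<in>D. h (K \<inter> {..b}) + h (K \<inter> {b..}))"
    unfolding division_variation_def
  proof (rule sum_mono)
    fix K assume "K \<in> D"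
    then obtain u v where uv: "u \<le> v" "K = {u..v}"
      using division_real_cases[OF D] by metis
    consider "v \<le> b" | "b \<le> u" | "u < b" "b < v" by linarith
    then show "norm (f (Sup K) - f (Inf K)) \<le> h (K \<inter> {..b}) + h (K \<inter> {b..})"
    proof cases
      case 1
      then have "K \<inter> {..b} = K" using uv by auto
      then show ?thesis using uv by (simp add: h_def)
    next
      case 2
      then have "K \<inter> {b..} = K" using uv by auto
      then show ?thesis using uv by (simp add: h_def)
    next
      case 3
      then have "K \<inter> {..b} = {u..b}" "K \<inter> {b..} = {b..v}" using uv by auto
      moreover have "norm (f v - f u) \<le> norm (f b - f u) + norm (f v - f b)"
        using norm_triangle_ineq[of "f b - f u" "f v - f b"] by simp
      ultimately show ?thesis using uv 3 by (simp add: h_def)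
    qed
  qed
  then show ?thesis using that[OF d1 d2] by (simp add: sum.distrib s1 s2)
qed

locale bounded_variation =
  fixes f :: "real \<Rightarrow> 'a::real_normed_vector"
  assumes bv: "bounded_variation_on {0..} f"
begin

lemma bdd_division_variation:
  assumes "0 \<le> a"
  shows "bdd_above (division_variation f ` {D. D division_of {a..b}})"
proof -
  obtain V where "\<And>a b D. {a..b} \<subseteq> {0..} \<Longrightarrow> D division_of {a..b} \<Longrightarrow> division_variation f D \<le> V"
    using bv unfolding bounded_variation_on_def division_variation_def by blast
  then show ?thesis using assms by (intro bdd_aboveI2[of _ _ V]) auto
qed

lemma division_variation_le_variation:
  assumes "0 \<le> a" "D division_of {a..b}"
  shows "division_variation f D \<le> variation f a b"
  unfolding variation_def
  by (rule cSUP_upper[OF _ bdd_division_variation]) (use assms in simp_all)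

lemma variation_approx:
  assumes "0 \<le> a" "a \<le> b" "e > 0"
  obtains D where "D division_of {a..b}" "variation f a b < division_variation f D + e"
proof -
  have "{{a..b}} division_of {a..b}" using division_of_self[of a b] assms by simp
  then have "{D. D division_of {a..b}} \<noteq> {}" by blast
  then have "\<exists>D\<in>{D. D division_of {a..b}}. variation f a b - e < division_variation f D"
    using less_cSUP_iff[OF _ bdd_division_variation[OF assms(1)], of b "variation f a b - e"] assms(3)
    by (simp add: variation_def)
  then obtain D where "D division_of {a..b}" "variation f a b - e < division_variation f D"
    by auto
  then show ?thesis using that[of D] by simp
qed

lemma norm_diff_le_variation:
  assumes "0 \<le> a" "a \<le> b"
  shows "norm (f b - f a) \<le> variation f a b"
proof -
  have "{{a..b}} division_of {a..b}" using division_of_self[of a b] assms by simp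
  from division_variation_le_variation[OF assms(1) this] show ?thesis
    using assms by (simp add: division_variation_def)
qed

text \<open>One inequality cuts a nearly optimal division of \<open>{a..c}\<close> at
  \<open>b\<close>; the other joins nearly optimal divisions of the two pieces.\<close>

lemma variation_add:
  assumes "0 \<le> a" "a \<le> b" "b \<le> c"
  shows "variation f a c = variation f a b + variation f b c"
proof (rule antisym)
  show "variation f a c \<le> variation f a b + variation f b c"
  proof (rule field_le_epsilon)
    fix e :: real assume "e > 0"
    obtain D where D: "D division_of {a..c}" "variation f a c < division_variation f D + e"
      using variation_approx[of a c e] assms \<open>e > 0\<close> by auto
    obtain D1 D2 where "D1 division_of {a..b}" "D2 division_of {b..c}"
      "division_variation f D \<le> division_variation f D1 + division_variation f D2"
      using division_variation_split[OF D(1) assms(2,3), of f] by metis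
    then show "variation f a c \<le> variation f a b + variation f b c + e"
      using D(2) division_variation_le_variation[of a D1 b] division_variation_le_variation[of b D2 c] assms
      by linarith
  qed
  show "variation f a b + variation f b c \<le> variation f a c"
  proof (rule field_le_epsilon)
    fix e :: real assume e: "e > 0"
    obtain D1 where D1: "D1 division_of {a..b}" "variation f a b < division_variation f D1 + e/2"
      using variation_approx[of a b "e/2"] assms e by auto
    obtain D2 where D2: "D2 division_of {b..c}" "variation f b c < division_variation f D2 + e/2"
      using variation_approx[of b c "e/2"] assms e by auto
    note U = division_variation_Un[OF D1(1) D2(1) assms(2,3)]
    show "variation f a b + variation f b c \<le> variation f a c + e"
      using division_variation_le_variation[OF assms(1) U(1)] U(2)[of f] D1(2) D2(2) by linarith
  qed
qed

lemma bounded_total_variation: "\<exists>B. \<forall>x\<ge>0. variation f 0 x \<le> B"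
proof -
  obtain V where V: "\<And>a b D. {a..b} \<subseteq> {0..} \<Longrightarrow> D division_of {a..b} \<Longrightarrow> division_variation f D \<le> V"
    using bv unfolding bounded_variation_on_def division_variation_def by blast
  have "variation f 0 x \<le> V + 1" if x: "x \<ge> 0" for x
  proof -
    obtain D where D: "D division_of {0..x}" "variation f 0 x < division_variation f D + 1"
      using variation_approx[of 0 x 1] x by auto
    then show ?thesis using V[of 0 x D] by auto
  qed
  then show ?thesis by blast
qed

lemma variation_absolutely_continuous:
  assumes lac: "locally_absolutely_continuous_on {0..} f"
  shows "locally_absolutely_continuous_on {0..} (variation f 0)"
  unfolding locally_absolutely_continuous_on_def absolutely_continuous_on_def
proof (intro allI impI)
  fix a b e :: real assume ab: "{a..b} \<subseteq> {0..}" and e: "e > 0"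
  obtain d where d: "d > 0" and dD: "\<And>D T. D division_of T \<Longrightarrow> T \<subseteq> {a..b} \<Longrightarrow> (\<Sum>K\<in>D. Sup K - Inf K) < d
      \<Longrightarrow> division_variation f D < e/2"
    using lac ab e unfolding locally_absolutely_continuous_on_def absolutely_continuous_on_def
      division_variation_def by (meson half_gt_zero)
  show "\<exists>d>0. \<forall>D T. D division_of T \<and> T \<subseteq> {a..b} \<and> (\<Sum>K\<in>D. Sup K - Inf K) < d \<longrightarrow>
       (\<Sum>K\<in>D. norm (variation f 0 (Sup K) - variation f 0 (Inf K))) < e"
  proof (intro exI conjI allI impI, rule d, elim conjE)
    fix D T assume D: "D division_of T" and T: "T \<subseteq> {a..b}" and len: "(\<Sum>K\<in>D. Sup K - Inf K) < d"
    \<comment> \<open>Refining each interval by a nearly optimal division turns \<open>D\<close> into another division of the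
      same set \<open>T\<close>, to which the absolute continuity of \<open>f\<close> applies.\<close>
    define \<eta> where "\<eta> = e / 2 / (real (card D) + 1)"
    have \<eta>: "\<eta> > 0" using e by (simp add: \<eta>_def)
    have pos: "0 \<le> Inf K \<and> Inf K \<le> Sup K \<and> K = {Inf K..Sup K}" if K: "K \<in> D" for K
    proof -
      obtain u v where uv: "u \<le> v" "K = {u..v}" "Inf K = u" "Sup K = v"
        using division_real_cases[OF D K] by metis
      have "K \<subseteq> {0..}" using K D T ab by (meson division_ofD(2) order_trans)
      then show ?thesis using uv by auto
    qed
    have "\<forall>K\<in>D. \<exists>E. E division_of K \<and> variation f (Inf K) (Sup K) < division_variation f E + \<eta>"
    proof
      fix K assume "K \<in> D"
      then have "0 \<le> Inf K" "Inf K \<le> Sup K" "K = {Inf K..Sup K}" using pos by auto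
      then show "\<exists>E. E division_of K \<and> variation f (Inf K) (Sup K) < division_variation f E + \<eta>"
        using variation_approx[of "Inf K" "Sup K" \<eta>] \<eta> by metis
    qed
    then obtain p where p: "\<And>K. K \<in> D \<Longrightarrow> p K division_of K"
        "\<And>K. K \<in> D \<Longrightarrow> variation f (Inf K) (Sup K) < division_variation f (p K) + \<eta>"
      by metis
    note U = sum_UNION_division[where h="\<lambda>K. norm (f (Sup K) - f (Inf K))", OF D p(1)]
    have "(\<Sum>K\<in>D. norm (variation f 0 (Sup K) - variation f 0 (Inf K))) = (\<Sum>K\<in>D. variation f (Inf K) (Sup K))"
    proof (rule sum.cong)
      fix K assume K: "K \<in> D"
      then have "variation f 0 (Sup K) = variation f 0 (Inf K) + variation f (Inf K) (Sup K)"
        using pos variation_add by auto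
      moreover have "variation f (Inf K) (Sup K) \<ge> 0"
        using norm_diff_le_variation[of "Inf K" "Sup K"] pos[OF K] norm_ge_zero order_trans by blast
      ultimately show "norm (variation f 0 (Sup K) - variation f 0 (Inf K)) = variation f (Inf K) (Sup K)"
        by simp
    qed simp
    also have "\<dots> \<le> (\<Sum>K\<in>D. division_variation f (p K) + \<eta>)"
      by (intro sum_mono less_imp_le p)
    also have "\<dots> = division_variation f (\<Union>K\<in>D. p K) + card D * \<eta>"
      unfolding division_variation_def by (subst U(2)) (auto simp: sum.distrib)
    \<comment> \<open>There is one approximation error \<eta> per member of \<open>D\<close>. The
      added 1 in the denominator of \<eta> keeps it positive when \<open>D\<close> is empty.\<close>
    also have "card D * \<eta> \<le> e/2"
      using e by (simp add: \<eta>_def field_simps)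
    also have "division_variation f (\<Union>K\<in>D. p K) < e/2"
      by (rule dD[OF U(1) T])
        (use len in \<open>auto simp: sum_length_division[OF U(1)] sum_length_division[OF D]\<close>)
    finally show "(\<Sum>K\<in>D. norm (variation f 0 (Sup K) - variation f 0 (Inf K))) < e" by simp
  qed
qed

end

section \<open>Absolutely continuous functions as indefinite integrals\<close>

lemma division_endpoints:
  fixes D :: "real set set"
  assumes "D division_of T" "T \<subseteq> S" "K \<in> D"
  shows "Inf K \<in> S" "Sup K \<in> S" "Inf K \<le> Sup K" "K = {Inf K..Sup K}"
proof -
  obtain u v where uv: "u \<le> v" "K = {u..v}" "Inf K = u" "Sup K = v"
    using division_real_cases[OF assms(1,3)] by metis
  have "K \<subseteq> S" using division_ofD(2)[OF assms(1,3)] assms(2) by auto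
  then show "Inf K \<in> S" "Sup K \<in> S" "Inf K \<le> Sup K" "K = {Inf K..Sup K}" using uv by auto
qed

text \<open>The \<delta> that \<open>h\<close> has for \<open>e / C\<close> serves \<open>g\<close>
  for \<open>e\<close>. This carries absolute continuity from \<open>F\<close> to its extension to
  the line, and from the variation to its sums with the real and imaginary parts.\<close>

lemma absolutely_continuous_on_dominated:
  assumes h: "absolutely_continuous_on S h" and "C > 0"
    and le: "\<And>x y. x \<in> S \<Longrightarrow> y \<in> S \<Longrightarrow> norm (g y - g x) \<le> C * norm (h y - h x)"
  shows "absolutely_continuous_on S g"
  unfolding absolutely_continuous_on_def
proof (intro allI impI)
  fix e :: real assume "e > 0"
  then have "e / C > 0" using \<open>C > 0\<close> by simp
  then obtain d where d: "d > 0" "\<And>D T. D division_of T \<Longrightarrow> T \<subseteq> S \<Longrightarrow> (\<Sum>K\<in>D. Sup K - Inf K) < d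
      \<Longrightarrow> (\<Sum>K\<in>D. norm (h (Sup K) - h (Inf K))) < e / C"
    using h unfolding absolutely_continuous_on_def by meson
  show "\<exists>\<delta>>0. \<forall>D T. D division_of T \<and> T \<subseteq> S \<and> (\<Sum>K\<in>D. Sup K - Inf K) < \<delta> \<longrightarrow>
       (\<Sum>K\<in>D. norm (g (Sup K) - g (Inf K))) < e"
  proof (intro exI conjI allI impI, rule d(1), elim conjE)
    fix D T assume D: "D division_of T" and T: "T \<subseteq> S" and len: "(\<Sum>K\<in>D. Sup K - Inf K) < d"
    have "(\<Sum>K\<in>D. norm (g (Sup K) - g (Inf K))) \<le> (\<Sum>K\<in>D. C * norm (h (Sup K) - h (Inf K)))"
      by (intro sum_mono le division_endpoints[OF D T])
    also have "\<dots> = C * (\<Sum>K\<in>D. norm (h (Sup K) - h (Inf K)))"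
      by (simp add: sum_distrib_left)
    also have "\<dots> < e"
      using d(2)[OF D T len] \<open>C > 0\<close> by (simp add: field_simps)
    finally show "(\<Sum>K\<in>D. norm (g (Sup K) - g (Inf K))) < e" .
  qed
qed

text \<open>Applied to the one-member division \<open>{{u..v}}\<close>, the definition gives uniform
  continuity.\<close>

lemma absolutely_continuous_on_imp_continuous_on:
  assumes "absolutely_continuous_on {a..b} f"
  shows "continuous_on {a..b} f"
  unfolding continuous_on_iff
proof (intro ballI allI impI)
  fix x e :: real assume x: "x \<in> {a..b}" and e: "e > 0"
  obtain d where d: "d > 0" "\<And>D T. D division_of T \<Longrightarrow> T \<subseteq> {a..b} \<Longrightarrow> (\<Sum>K\<in>D. Sup K - Inf K) < d
      \<Longrightarrow> (\<Sum>K\<in>D. norm (f (Sup K) - f (Inf K))) < e"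
    using assms e unfolding absolutely_continuous_on_def by meson
  have *: "norm (f v - f u) < e" if "u \<le> v" "u \<in> {a..b}" "v \<in> {a..b}" "v - u < d" for u v
  proof -
    have "{{u..v}} division_of {u..v}" using division_of_self[of u v] that(1) by simp
    from d(2)[OF this] show ?thesis using that by auto
  qed
  show "\<exists>d>0. \<forall>y\<in>{a..b}. dist y x < d \<longrightarrow> dist (f y) (f x) < e"
  proof (intro exI conjI ballI impI, rule d(1))
    fix y assume "y \<in> {a..b}" "dist y x < d"
    then show "dist (f y) (f x) < e"
      using *[of x y] *[of y x] x by (cases "x \<le> y") (auto simp: dist_norm norm_minus_commute)
  qed
qed

section \<open>Null sets and densities of Stieltjes measures\<close>

text \<open>\<open>N\<close> is covered by non-overlapping intervals inside \<open>{a..b}\<close> of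
  total length below the \<delta> for \<open>e\<close>. Every finite subfamily has total increment
  of \<open>G\<close>, that is measure, below \<open>e\<close>, and continuity from below extends
  the bound to the whole cover. Continuity of \<open>G\<close> excludes atoms, so a closed interval
  has measure equal to its increment.\<close>

lemma interval_measure_null_of_absolutely_continuous:
  assumes mono: "\<And>x y. x \<le> y \<Longrightarrow> G x \<le> G y" and cont: "continuous_on UNIV G"
    and ac: "absolutely_continuous_on {a..b} G"
    and N: "N \<in> null_sets lborel" "N \<subseteq> {a..b}"
  shows "N \<in> null_sets (interval_measure G)"
proof -
  let ?\<mu> = "interval_measure G"
  have E: "emeasure ?\<mu> {u..v} = ennreal (G v - G u)" if "u \<le> v" for u v
    by (rule emeasure_interval_measure_Icc[OF that mono cont])
  \<comment> \<open>The summand 0 gives the shape expected by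
    \<open>ennreal_le_epsilon\<close>.\<close>
  have small: "emeasure ?\<mu> N \<le> 0 + ennreal e" if e: "e > 0" for e
  proof -
    obtain d where d: "d > 0" "\<And>D T. D division_of T \<Longrightarrow> T \<subseteq> {a..b} \<Longrightarrow> (\<Sum>K\<in>D. Sup K - Inf K) < d
        \<Longrightarrow> (\<Sum>K\<in>D. norm (G (Sup K) - G (Inf K))) < e"
      using ac e unfolding absolutely_continuous_on_def by meson
    have N0: "N \<in> null_sets lebesgue"
      using N(1) null_sets_completionI by blast
    then have Nm: "N \<in> lmeasurable" "measure lebesgue N = 0"
      by (auto intro: fmeasurableI_null_sets measure_eq_0_null_sets)
    have Nab: "N \<subseteq> cbox a b" using N(2) by simp
    \<comment> \<open>Half of \<open>d\<close> leaves room to turn the non-strict bound on the cover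
      into the strict one that absolute continuity asks for.\<close>
    have d2: "d / 2 > 0" using d by simp
    obtain \<D> where \<D>: "countable \<D>"
        "\<And>K. K \<in> \<D> \<Longrightarrow> K \<subseteq> cbox a b \<and> K \<noteq> {} \<and> (\<exists>c d. K = cbox c d)"
        "pairwise (\<lambda>A B. interior A \<inter> interior B = {}) \<D>"
        "N \<subseteq> \<Union>\<D>" "\<Union>\<D> \<in> lmeasurable" "measure lebesgue (\<Union>\<D>) \<le> measure lebesgue N + d / 2"
      by (rule measurable_outer_intervals_bounded[OF Nm(1) Nab d2]) blast
    show ?thesis
    proof (cases "\<D> = {}")
      case True
      then show ?thesis using \<D>(4) by auto
    next
      case False
      \<comment> \<open>Absolute continuity speaks of finite divisions, so the countable cover is
        exhausted by the finite families of its first members in an enumeration, possibly with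
        repetitions.\<close>
      define E where "E n = from_nat_into \<D> ` {..n}" for n :: nat
      have E\<D>: "E n \<subseteq> \<D>" for n
        using from_nat_into[OF False] by (auto simp: E_def)
      have UE: "(\<Union>n. \<Union>(E n)) = \<Union>\<D>"
      proof -
        have "\<Union>(range E) = range (from_nat_into \<D>)" by (auto simp: E_def)
        also have "\<dots> = \<D>" by (rule range_from_nat_into[OF False \<D>(1)])
        finally show ?thesis by blast
      qed
      have divE: "E n division_of \<Union>(E n)" for n
      proof (rule division_ofI)
        show "finite (E n)" by (simp add: E_def)
        show "K \<noteq> {}" "\<exists>a b. K = cbox a b" if "K \<in> E n" for K
          using \<D>(2) E\<D> that by blast+
        show "interior K1 \<inter> interior K2 = {}" if "K1 \<in> E n" "K2 \<in> E n" "K1 \<noteq> K2" for K1 K2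
          using \<D>(3) E\<D>[of n] that unfolding pairwise_def by blast
      qed auto
      have meas: "K \<in> sets ?\<mu>" if K: "K \<in> E n" for K n
      proof -
        obtain c d where "K = cbox c d" using \<D>(2) E\<D>[of n] K by blast
        then show ?thesis by simp
      qed
      have subE: "\<Union>(E n) \<subseteq> {a..b}" for n
        using \<D>(2) E\<D>[of n] by auto
      have le: "emeasure ?\<mu> (\<Union>(E n)) \<le> ennreal e" for n
      proof -
        have "(\<Sum>K\<in>E n. Sup K - Inf K) = measure lebesgue (\<Union>(E n))"
          by (rule sum_length_division[OF divE])
        also have "\<dots> \<le> measure lebesgue (\<Union>\<D>)"
        proof (rule measure_mono_fmeasurable)
          have "K \<in> sets borel" if "K \<in> E n" for K using meas[OF that] by simp
          then have "\<Union>(E n) \<in> sets borel"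
            by (intro sets.finite_Union) (auto simp: E_def)
          then show "\<Union>(E n) \<in> sets lebesgue" by (simp add: sets_completionI_sets)
        qed (use E\<D> \<D> in auto)
        also have "\<dots> < d" using \<D>(6) Nm d by simp
        finally have s: "(\<Sum>K\<in>E n. norm (G (Sup K) - G (Inf K))) < e"
          by (rule d(2)[OF divE subE])
        have "emeasure ?\<mu> (\<Union>K\<in>E n. K) \<le> (\<Sum>K\<in>E n. emeasure ?\<mu> K)"
          by (rule emeasure_subadditive_finite) (use meas in \<open>auto simp: E_def\<close>)
        also have "\<dots> = (\<Sum>K\<in>E n. ennreal (norm (G (Sup K) - G (Inf K))))"
        proof (rule sum.cong)
          fix K assume K: "K \<in> E n"
          have "emeasure ?\<mu> {Inf K..Sup K} = ennreal (norm (G (Sup K) - G (Inf K)))"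
            using E[OF division_endpoints(3)[OF divE subE K]] mono[OF division_endpoints(3)[OF divE subE K]]
            by simp
          then show "emeasure ?\<mu> K = ennreal (norm (G (Sup K) - G (Inf K)))"
            using division_endpoints(4)[OF divE subE K] by simp
        qed simp
        also have "\<dots> = ennreal (\<Sum>K\<in>E n. norm (G (Sup K) - G (Inf K)))"
          by (rule sum_ennreal) simp
        also have "\<dots> \<le> ennreal e" using s by (simp add: ennreal_leI)
        finally show ?thesis by simp
      qed
      have "emeasure ?\<mu> N \<le> emeasure ?\<mu> (\<Union>n. \<Union>(E n))"
      proof (rule emeasure_mono)
        show "N \<subseteq> (\<Union>n. \<Union>(E n))" using \<D>(4) UE by simp
        have "\<Union>(E n) \<in> sets ?\<mu>" for n
          by (intro sets.finite_Union) (use meas in \<open>auto simp: E_def\<close>)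
        then show "(\<Union>n. \<Union>(E n)) \<in> sets ?\<mu>" by blast
      qed
      also have "\<dots> = (SUP n. emeasure ?\<mu> (\<Union>(E n)))"
      proof (rule SUP_emeasure_incseq[symmetric])
        show "range (\<lambda>n. \<Union>(E n)) \<subseteq> sets ?\<mu>"
          using meas by (auto intro!: sets.finite_Union simp: E_def)
        show "incseq (\<lambda>n. \<Union>(E n))"
          unfolding E_def by (intro incseq_SucI Union_mono image_mono) auto
      qed
      also have "\<dots> \<le> ennreal e" by (rule SUP_least) (rule le)
      finally show ?thesis by simp
    qed
  qed
  have "emeasure ?\<mu> N \<le> 0"
    by (rule ennreal_le_epsilon) (rule small)
  then show ?thesis using N(1) by (auto simp: null_sets_def)
qed

lemma UN_symmetric_intervals: "(\<Union>n. {- real n..real n}) = UNIV"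
proof -
  have "x \<in> (\<Union>n. {- real n..real n})" for x
  proof -
    obtain n where "\<bar>x\<bar> \<le> real n" using real_arch_simple by blast
    then have "x \<in> {- real n..real n}" by (auto simp: abs_le_iff)
    then show ?thesis by blast
  qed
  then show ?thesis by blast
qed

text \<open>This is Radon-Nikodym for the Stieltjes measure of \<open>F\<close> with respect to
  Lebesgue measure; the bound on \<open>F\<close> makes the density integrable.\<close>

lemma mono_absolutely_continuous_density:
  fixes F :: "real \<Rightarrow> real"
  assumes lac: "locally_absolutely_continuous_on {0..} F"
    and mono: "\<And>x y. 0 \<le> x \<Longrightarrow> x \<le> y \<Longrightarrow> F x \<le> F y"
    and bdd: "\<And>x. 0 \<le> x \<Longrightarrow> F x \<le> B"
  obtains g where "integrable lborel g" "\<And>x. 0 \<le> x \<Longrightarrow> F x - F 0 = (LINT t:{0..x}|lborel. g t)"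
proof -
  \<comment> \<open>\<open>interval_measure\<close> is used with a monotone continuous function on
    the whole line. The constant extension by \<open>F 0\<close> gives the negative half-line
    measure zero.\<close>
  define G where "G x = F (max 0 x)" for x
  let ?\<mu> = "interval_measure G"
  have ac: "absolutely_continuous_on {0..b} F" for b
    using lac unfolding locally_absolutely_continuous_on_def by auto
  have acG: "absolutely_continuous_on {0..b} G" for b
    by (rule absolutely_continuous_on_dominated[OF ac, of 1]) (auto simp: G_def)
  have monoG: "G x \<le> G y" if "x \<le> y" for x y
    unfolding G_def by (rule mono) (use that in auto)
  have contG: "continuous_on UNIV G"
  proof -
    have "isCont G x" for x
    proof -
      have "continuous_on {..<x+1} (\<lambda>x. F (max 0 x))"
      proof (rule continuous_on_compose2[where g=F and f="max 0"])
        show "continuous_on {0..max 0 (x+1)} F"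
          by (rule absolutely_continuous_on_imp_continuous_on[OF ac])
      qed (intro continuous_intros, auto)
      then show ?thesis
        by (simp add: G_def[abs_def] continuous_on_eq_continuous_at)
    qed
    then show ?thesis by (simp add: continuous_at_imp_continuous_on)
  qed
  have E: "emeasure ?\<mu> {u..v} = ennreal (G v - G u)" if "u \<le> v" for u v
    by (rule emeasure_interval_measure_Icc[OF that monoG contG])
  have abs: "absolutely_continuous lborel ?\<mu>"
    unfolding absolutely_continuous_def
  proof
    fix N :: "real set" assume N: "N \<in> null_sets lborel"
    \<comment> \<open>Absolute continuity is available on compact intervals, so a null set is
      treated piece by piece and reassembled as a countable union.\<close>
    have "N \<inter> {- real n..real n} \<in> null_sets ?\<mu>" for n
    proof -
      have N2: "N \<inter> {0..real n} \<in> null_sets lborel"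
        using N by (simp add: null_set_Int2)
      have "emeasure ?\<mu> {- real n..0} = 0" using E[of "- real n" 0] by (simp add: G_def)
      then have 1: "{- real n..0} \<in> null_sets ?\<mu>" by (simp add: null_sets_def)
      have 2: "N \<inter> {0..real n} \<in> null_sets ?\<mu>"
        by (rule interval_measure_null_of_absolutely_continuous[OF monoG contG acG N2]) auto
      show ?thesis
        by (rule null_sets_subset[OF null_sets.Un[OF 1 2]]) (use N in auto)
    qed
    then have "(\<Union>n. N \<inter> {- real n..real n}) \<in> null_sets ?\<mu>" by (rule null_sets_UN)
    moreover have "(\<Union>n. N \<inter> {- real n..real n}) = N"
      using UN_symmetric_intervals by blast
    ultimately show "N \<in> null_sets ?\<mu>" by simp
  qed
  have total: "emeasure ?\<mu> UNIV \<le> ennreal (B - F 0)"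
  proof -
    have "emeasure ?\<mu> UNIV = (SUP n. emeasure ?\<mu> {- real n..real n})"
      by (subst SUP_emeasure_incseq) (auto simp: incseq_def UN_symmetric_intervals)
    also have "\<dots> \<le> ennreal (B - F 0)"
      by (rule SUP_least) (use E bdd in \<open>auto simp: G_def intro!: ennreal_leI\<close>)
    finally show ?thesis .
  qed
  obtain h where h: "h \<in> borel_measurable lborel" "density lborel h = ?\<mu>"
    using sigma_finite_measure.Radon_Nikodym[OF lborel.sigma_finite_measure_axioms abs] by auto
  have hint: "emeasure ?\<mu> A = (\<integral>\<^sup>+t\<in>A. h t \<partial>lborel)" if "A \<in> sets borel" for A
    unfolding h(2)[symmetric] using h(1) that by (simp add: emeasure_density)
  have "(\<integral>\<^sup>+t. h t \<partial>lborel) < \<infinity>"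
    using hint[of UNIV] le_less_trans[OF total ennreal_less_top] by simp
  \<comment> \<open>The density takes extended values. Its integral is finite, so it is finite
    almost everywhere and \<open>enn2real\<close> alters nothing outside a null set.\<close>
  then have "AE t in lborel. h t \<noteq> \<infinity>"
    using h(1) by (intro nn_integral_noteq_infinite) auto
  then have AEh: "AE t in lborel. ennreal (enn2real (h t)) = h t"
    by eventually_elim (simp add: ennreal_enn2real_if)
  have meas: "(\<lambda>t. enn2real (h t)) \<in> borel_measurable lborel" using h(1) by measurable
  show ?thesis
  proof (rule that)
    show "integrable lborel (\<lambda>t. enn2real (h t))"
    proof (rule integrableI_nonneg[OF meas])
      have "(\<integral>\<^sup>+t. ennreal (enn2real (h t)) \<partial>lborel) = (\<integral>\<^sup>+t. h t \<partial>lborel)"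
        by (rule nn_integral_cong_AE[OF AEh])
      then show "(\<integral>\<^sup>+t. ennreal (enn2real (h t)) \<partial>lborel) < \<infinity>"
        using \<open>(\<integral>\<^sup>+t. h t \<partial>lborel) < \<infinity>\<close> by simp
    qed simp
    fix x :: real assume x: "0 \<le> x"
    have "(LINT t:{0..x}|lborel. enn2real (h t))
        = enn2real (\<integral>\<^sup>+t. ennreal (indicator {0..x} t * enn2real (h t)) \<partial>lborel)"
      unfolding set_lebesgue_integral_def real_scaleR_def
      by (rule integral_eq_nn_integral) (use meas in auto)
    also have "(\<integral>\<^sup>+t. ennreal (indicator {0..x} t * enn2real (h t)) \<partial>lborel) = (\<integral>\<^sup>+t\<in>{0..x}. h t \<partial>lborel)"
      by (rule nn_integral_cong_AE, use AEh in eventually_elim) (auto simp: indicator_def)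
    also have "\<dots> = ennreal (F x - F 0)"
      using hint[of "{0..x}"] E[OF x] x by (simp add: G_def)
    finally show "F x - F 0 = (LINT t:{0..x}|lborel. enn2real (h t))"
      using mono[of 0 x] x by simp
  qed
qed

lemma absolutely_continuous_bounded_variation_density:
  fixes f :: "real \<Rightarrow> complex"
  assumes lac: "locally_absolutely_continuous_on {0..} f" and bv: "bounded_variation_on {0..} f"
  obtains g where "integrable lborel g" "\<And>x. 0 \<le> x \<Longrightarrow> f x - f 0 = (LINT t:{0..x}|lborel. g t)"
proof -
  interpret bounded_variation f by unfold_locales (rule bv)
  define V where "V = variation f 0"
  obtain B where B: "\<And>x. x \<ge> 0 \<Longrightarrow> V x \<le> B"
    using bounded_total_variation unfolding V_def by blast
  have V: "norm (f y - f x) \<le> V y - V x" if "0 \<le> x" "x \<le> y" for x y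
    using variation_add[of 0 x y] norm_diff_le_variation[of x y] that by (simp add: V_def)
  have lacV: "locally_absolutely_continuous_on {0..} V"
    unfolding V_def by (rule variation_absolutely_continuous[OF lac])
  \<comment> \<open>Since \<open>V\<close> dominates the increments of \<open>f\<close>, the functions \<open>V\<close>, \<open>V + Re f\<close> and \<open>V + Im f\<close>
    are all nondecreasing, bounded and absolutely continuous.\<close>
  have ex: "\<exists>g. integrable lborel g \<and> (\<forall>x\<ge>0. V x + u x - (V 0 + u 0) = (LINT t:{0..x}|lborel. g t))"
    if u: "\<And>x y. \<bar>u x - u y\<bar> \<le> norm (f x - f y)" for u :: "real \<Rightarrow> real"
  proof -
    have mono: "V x + u x \<le> V y + u y" if "0 \<le> x" "x \<le> y" for x y
      using V[OF that] u[of y x] by linarith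
    have lacVu: "locally_absolutely_continuous_on {0..} (\<lambda>x. V x + u x)"
      unfolding locally_absolutely_continuous_on_def
    proof (intro allI impI)
      fix a b :: real assume ab: "{a..b} \<subseteq> {0..}"
      \<comment> \<open>\<open>u\<close> moves no more than \<open>f\<close>, and \<open>f\<close>
        no more than \<open>V\<close>, so adding \<open>u\<close> at most doubles the
        increments.\<close>
      have dom: "\<bar>V y + u y - (V x + u x)\<bar> \<le> 2 * \<bar>V y - V x\<bar>" if "0 \<le> x" "0 \<le> y" for x y
      proof -
        have "\<bar>u y - u x\<bar> \<le> \<bar>V y - V x\<bar>"
        proof (cases "x \<le> y")
          case True
          from V[OF that(1) True] u[of y x] show ?thesis by linarith
        next
          case False
          then have "y \<le> x" by simp
          from V[OF that(2) this] u[of x y] show ?thesis by linarith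
        qed
        moreover have "\<bar>V y + u y - (V x + u x)\<bar> \<le> \<bar>V y - V x\<bar> + \<bar>u y - u x\<bar>"
          using abs_triangle_ineq[of "V y - V x" "u y - u x"] by (simp add: algebra_simps)
        ultimately show ?thesis by simp
      qed
      have "absolutely_continuous_on {a..b} V"
        using lacV ab unfolding locally_absolutely_continuous_on_def by blast
      then show "absolutely_continuous_on {a..b} (\<lambda>x. V x + u x)"
      proof (rule absolutely_continuous_on_dominated[where C=2])
        fix x y assume "x \<in> {a..b}" "y \<in> {a..b}"
        then have "0 \<le> x" "0 \<le> y" using ab by auto
        then show "norm (V y + u y - (V x + u x)) \<le> 2 * norm (V y - V x)"
          using dom by simp
      qed simp
    qed
    have bddVu: "V x + u x \<le> 2 * B - V 0 + u 0" if "x \<ge> 0" for x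
      using B[OF that] V[OF order_refl that] u[of x 0] by linarith
    obtain g where "integrable lborel g"
        "\<And>x. 0 \<le> x \<Longrightarrow> V x + u x - (V 0 + u 0) = (LINT t:{0..x}|lborel. g t)"
      using mono_absolutely_continuous_density[OF lacVu mono bddVu] by blast
    then show ?thesis by blast
  qed
  obtain g1 where g1: "integrable lborel g1" "\<And>x. 0 \<le> x \<Longrightarrow> V x - V 0 = (LINT t:{0..x}|lborel. g1 t)"
    using ex[of "\<lambda>_. 0"] by auto
  obtain g2 where g2: "integrable lborel g2"
      "\<And>x. 0 \<le> x \<Longrightarrow> V x + Re (f x) - (V 0 + Re (f 0)) = (LINT t:{0..x}|lborel. g2 t)"
    using ex[of "\<lambda>x. Re (f x)"] abs_Re_le_cmod[of "f _ - f _"] by auto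
  obtain g3 where g3: "integrable lborel g3"
      "\<And>x. 0 \<le> x \<Longrightarrow> V x + Im (f x) - (V 0 + Im (f 0)) = (LINT t:{0..x}|lborel. g3 t)"
    using ex[of "\<lambda>x. Im (f x)"] abs_Im_le_cmod[of "f _ - f _"] by auto
  have si: "set_integrable lborel {0..x} h" if "integrable lborel h" for h :: "real \<Rightarrow> 'b::{banach,second_countable_topology}" and x
    unfolding set_integrable_def using that by (intro integrable_mult_indicator) auto
  \<comment> \<open>Subtracting the density of \<open>V\<close> leaves densities of the real and
    imaginary parts of \<open>f\<close>.\<close>
  define g where "g t = complex_of_real (g2 t - g1 t) + \<i> * complex_of_real (g3 t - g1 t)" for t
  show ?thesis
  proof (rule that)
    show "integrable lborel g"
      unfolding g_def using g1(1) g2(1) g3(1)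
      by (intro Bochner_Integration.integrable_add integrable_mult_right integrable_of_real
           Bochner_Integration.integrable_diff) auto
    fix x :: real assume x: "0 \<le> x"
    have i: "set_integrable lborel {0..x} (\<lambda>t. complex_of_real (g2 t - g1 t))"
        "set_integrable lborel {0..x} (\<lambda>t. \<i> * complex_of_real (g3 t - g1 t))"
      using g1(1) g2(1) g3(1)
      by (auto intro!: si integrable_mult_right integrable_of_real Bochner_Integration.integrable_diff)
    have "(LINT t:{0..x}|lborel. g t)
       = complex_of_real (LINT t:{0..x}|lborel. g2 t - g1 t) + \<i> * complex_of_real (LINT t:{0..x}|lborel. g3 t - g1 t)"
      unfolding g_def using i
      by (simp add: set_integral_add set_integral_complex_of_real del: of_real_diff)
    also have "(LINT t:{0..x}|lborel. g2 t - g1 t) = Re (f x) - Re (f 0)"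
      using g1(2)[OF x] g2(2)[OF x] by (simp add: set_integral_diff(2) si g1(1) g2(1))
    also have "(LINT t:{0..x}|lborel. g3 t - g1 t) = Im (f x) - Im (f 0)"
      using g1(2)[OF x] g3(2)[OF x] by (simp add: set_integral_diff(2) si g1(1) g3(1))
    finally show "f x - f 0 = (LINT t:{0..x}|lborel. g t)"
      by (simp add: complex_eq_iff)
  qed
qed

section \<open>Lebesgue differentiation on the line\<close>

lemma lebesgue_differentiation_real:
  fixes g :: "real \<Rightarrow> 'a::euclidean_space"
  assumes int: "\<And>a b. g integrable_on {a..b}"
  obtains N where "negligible N"
    "\<And>a x. a < x \<Longrightarrow> x \<notin> N \<Longrightarrow> ((\<lambda>u. integral {a..u} g) has_vector_derivative g x) (at x)"
proof -
  \<comment> \<open>\<open>integrable_ccontinuous_explicit\<close> only gives right derivatives; left derivatives come from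
    the reflected function.\<close>
  have int': "(\<lambda>x. g (- x)) integrable_on {a..b}" for a b
    using int[of "-b" "-a"] Henstock_Kurzweil_Integration.integrable_reflect_real[where a="-b" and b="-a" and f=g] by simp
  \<comment> \<open>The differentiation theorem is stated for cubes along the sum of the basis
    vectors, which in dimension one is the number 1.\<close>
  have one: "(\<Sum>Basis) = (1::real)" by simp
  obtain N1 where N1: "negligible N1"
    "\<And>x e. x \<notin> N1 \<Longrightarrow> 0 < e \<Longrightarrow> \<exists>d>0. \<forall>h. 0 < h \<and> h < d \<longrightarrow>
        norm (integral {x..x + h} g /\<^sub>R h - g x) < e"
    using integrable_ccontinuous_explicit[of g] int by (auto simp: one)
  obtain N2 where N2: "negligible N2"
    "\<And>x e. x \<notin> N2 \<Longrightarrow> 0 < e \<Longrightarrow> \<exists>d>0. \<forall>h. 0 < h \<and> h < d \<longrightarrow>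
        norm (integral {x..x + h} (\<lambda>x. g (- x)) /\<^sub>R h - g (- x)) < e"
    using integrable_ccontinuous_explicit[of "\<lambda>x. g (- x)"] int' by (auto simp: one)
  show ?thesis
  proof
    show "negligible (N1 \<union> uminus ` N2)"
      using N1(1) N2(1)
      by (intro negligible_Un negligible_differentiable_image_negligible) (auto intro!: derivative_intros)
    fix a x assume ax: "a < x" and "x \<notin> N1 \<union> uminus ` N2"
    then have x1: "x \<notin> N1" and x2: "- x \<notin> N2" by (auto simp: image_iff)
    have scale: "norm (I - h *\<^sub>R g x) \<le> e * h" if "norm (I /\<^sub>R h - g x) < e" "h > 0" for I h e
    proof -
      have "I - h *\<^sub>R g x = h *\<^sub>R (I /\<^sub>R h - g x)" using that by (simp add: scaleR_diff_right)
      then have "norm (I - h *\<^sub>R g x) = h * norm (I /\<^sub>R h - g x)" using that by simp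
      also have "\<dots> \<le> h * e" using that by (intro mult_left_mono) auto
      finally show ?thesis by (simp add: mult.commute)
    qed
    show "((\<lambda>u. integral {a..u} g) has_vector_derivative g x) (at x)"
      unfolding has_vector_derivative_def has_derivative_within_alt
    proof (intro conjI allI impI)
      show "bounded_linear (\<lambda>h. h *\<^sub>R g x)" by (rule bounded_linear_scaleR_left)
      fix e :: real assume e: "e > 0"
      obtain d1 where d1: "d1 > 0" "\<And>h. 0 < h \<Longrightarrow> h < d1 \<Longrightarrow>
          norm (integral {x..x + h} g /\<^sub>R h - g x) < e"
        using N1(2)[OF x1 e] by blast
      obtain d2 where d2: "d2 > 0" "\<And>h. 0 < h \<Longrightarrow> h < d2 \<Longrightarrow>
          norm (integral {- x..- x + h} (\<lambda>x. g (- x)) /\<^sub>R h - g x) < e"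
        using N2(2)[OF x2 e] by auto
      \<comment> \<open>The bound \<open>x - a\<close> keeps \<open>y\<close> to the right of
        \<open>a\<close>, so that the integral from \<open>a\<close> to \<open>x\<close> can be
        split at \<open>y\<close>.\<close>
      define d where "d = min (min d1 d2) (x - a)"
      show "\<exists>d>0. \<forall>y\<in>UNIV. norm (y - x) < d \<longrightarrow>
          norm (integral {a..y} g - integral {a..x} g - (y - x) *\<^sub>R g x) \<le> e * norm (y - x)"
      proof (intro exI conjI ballI impI)
        show "d > 0" using d1 d2 ax by (simp add: d_def)
        fix y assume y: "norm (y - x) < d"
        consider "y = x" | "y > x" | "y < x" by linarith
        then show "norm (integral {a..y} g - integral {a..x} g - (y - x) *\<^sub>R g x) \<le> e * norm (y - x)"
        proof cases
          case 1
          then show ?thesis by simp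
        next
          case 2
          have "integral {a..y} g = integral {a..x} g + integral {x..y} g"
            using Henstock_Kurzweil_Integration.integral_combine[of a x y g] 2 ax int by simp
          then show ?thesis
            using scale[OF d1(2)[of "y - x"]] 2 y by (simp add: d_def)
        next
          case 3
          then have ay: "a \<le> y" using y by (simp add: d_def)
          have "integral {a..x} g = integral {a..y} g + integral {y..x} g"
            using Henstock_Kurzweil_Integration.integral_combine[of a y x g] 3 ay int by simp
          moreover have "integral {- x..- y} (\<lambda>x. g (- x)) = integral {y..x} g"
            by (rule Henstock_Kurzweil_Integration.integral_reflect_real)
          ultimately show ?thesis
            using scale[OF d2(2)[of "x - y"]] 3 y norm_minus_commute[of "integral {y..x} g" "(x - y) *\<^sub>R g x"]
            by (simp add: d_def algebra_simps)
        qed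
      qed
    qed
  qed
qed

section \<open>Integration by parts\<close>

lemma cosine_integral_by_parts:
  fixes f g :: "real \<Rightarrow> complex"
  assumes g: "integrable lborel g" and A: "0 \<le> A" and x: "x \<noteq> 0"
    and f: "\<And>t. 0 \<le> t \<Longrightarrow> f t - f 0 = (LINT s:{0..t}|lborel. g s)"
  shows "(LINT t:{0..A}|lborel. f t * complex_of_real (cos (x * t)))
    = f A * complex_of_real (sin (x * A) / x) - (LINT t:{0..A}|lborel. g t * complex_of_real (sin (x * t))) / complex_of_real x"
proof -
  \<comment> \<open>Fubini on the triangle \<open>0 \<le> t \<le> s \<le> A\<close>, with \<open>f A - f t\<close> written as an integral of \<open>g\<close>.\<close>
  define h where "h t s = (if 0 \<le> t \<and> t \<le> s \<and> s \<le> A then g s * complex_of_real (cos (x * t)) else 0)" for t s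
  have [measurable]: "g \<in> borel_measurable borel" using g by simp
  have hm [measurable]: "(\<lambda>(t, s). h t s) \<in> borel_measurable (lborel \<Otimes>\<^sub>M lborel)"
    unfolding h_def by measurable
  \<comment> \<open>The dominating function is integrable on the plane because \<open>{0..A}\<close>
    has finite measure and \<open>g\<close> is integrable; this justifies Fubini.\<close>
  have hle: "norm (h t s) \<le> indicator {0..A} t * norm (g s)" for t s
    by (auto simp: h_def norm_mult indicator_def intro!: mult_left_le)
  have hint: "integrable lborel (h t)" for t
  proof (rule Bochner_Integration.integrable_bound[OF g])
    show "h t \<in> borel_measurable lborel" unfolding h_def by measurable
    have "norm (h t s) \<le> norm (g s)" for s
      using hle[of t s] by (auto simp: indicator_def split: if_splits intro: order_trans)
    then show "AE s in lborel. norm (h t s) \<le> norm (g s)" by simp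
  qed
  have pair: "integrable (lborel \<Otimes>\<^sub>M lborel) (\<lambda>(t, s). h t s)"
  proof (rule lborel_pair.Fubini_integrable[OF hm])
    show "AE t in lborel. integrable lborel (\<lambda>s. case (t, s) of (t, s) \<Rightarrow> h t s)"
      using hint by simp
    have "integrable lborel (\<lambda>t. \<integral>s. norm (h t s) \<partial>lborel)"
    proof (rule Bochner_Integration.integrable_bound)
      show "integrable lborel (\<lambda>t. indicator {0..A} t * (\<integral>s. norm (g s) \<partial>lborel))"
        by (intro integrable_mult_left integrable_real_indicator) (simp_all add: emeasure_lborel_Icc_eq)
      show "AE t in lborel. norm (\<integral>s. norm (h t s) \<partial>lborel)
          \<le> norm (indicator {0..A} t * (\<integral>s. norm (g s) \<partial>lborel))"
      proof (rule AE_I2)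
        fix t :: real
        have "(\<integral>s. norm (h t s) \<partial>lborel) \<le> (\<integral>s. indicator {0..A} t * norm (g s) \<partial>lborel)"
          by (intro integral_mono integrable_norm hint integrable_mult_right g hle)
        then show "norm (\<integral>s. norm (h t s) \<partial>lborel) \<le> norm (indicator {0..A} t * (\<integral>s. norm (g s) \<partial>lborel))"
          by (simp add: abs_mult)
      qed
    qed measurable
    then show "integrable lborel (\<lambda>t. \<integral>s. norm (case (t, s) of (t, s) \<Rightarrow> h t s) \<partial>lborel)"
      by simp
  qed
  have si: "set_integrable lborel S g" if "S \<in> sets borel" for S
    unfolding set_integrable_def using g that by (intro integrable_mult_indicator) auto
  have inner_s: "(\<integral>s. h t s \<partial>lborel) = indicator {0..A} t *\<^sub>R ((f A - f t) * complex_of_real (cos (x * t)))" for t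
  proof (cases "t \<in> {0..A}")
    case True
    have "(LINT s:{0..A}|lborel. g s) = (LINT s:{0..t}|lborel. g s) + (LINT s:{t<..A}|lborel. g s)"
    proof -
      have "{0..A} = {0..t} \<union> {t<..A}" using True by auto
      moreover have "{0..t} \<inter> {t<..A} = {}" by auto
      ultimately show ?thesis by (simp add: set_integral_Un si)
    qed
    moreover have "(LINT s:{t<..A}|lborel. g s) = (LINT s:{t..A}|lborel. g s)"
    proof (rule set_integral_cong_set)
      have "AE s in lborel. s \<noteq> t" by (rule AE_lborel_singleton)
      then show "AE s in lborel. (s \<in> {t..A}) = (s \<in> {t<..A})" by eventually_elim auto
    qed (simp_all add: set_borel_measurable_def)
    ultimately have "(LINT s:{t..A}|lborel. g s) = f A - f t"
      using f[of t] f[of A] True by (simp add: algebra_simps)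
    moreover have "(\<integral>s. h t s \<partial>lborel) = (\<integral>s. (indicator {t..A} s *\<^sub>R g s) * complex_of_real (cos (x * t)) \<partial>lborel)"
      by (rule Bochner_Integration.integral_cong) (use True in \<open>auto simp: h_def\<close>)
    moreover have "\<dots> = (LINT s:{t..A}|lborel. g s) * complex_of_real (cos (x * t))"
      unfolding set_lebesgue_integral_def by (rule integral_mult_left_zero)
    ultimately show ?thesis using True by simp
  next
    case False
    then have "h t s = 0" for s by (auto simp: h_def)
    then show ?thesis using False by simp
  qed
  have FTC: "(LINT t:{0..s}|lborel. complex_of_real (cos (x * t))) = complex_of_real (sin (x * s) / x)" if "0 \<le> s" for s
  proof -
    have "(\<integral>t. cos (x * t) * indicator {0..s} t \<partial>lborel) = sin (x * s) / x - sin (x * 0) / x"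
      by (rule integral_FTC_Icc_real[OF that])
        (use x in \<open>auto intro!: derivative_eq_intros continuous_intros\<close>)
    then have "(LINT t:{0..s}|lborel. cos (x * t)) = sin (x * s) / x"
      by (simp add: set_lebesgue_integral_def mult.commute)
    then show ?thesis by (metis set_integral_complex_of_real)
  qed
  \<comment> \<open>In this order the cosine is integrated over \<open>{0..s}\<close>, which
    produces \<open>sin (x * s) / x\<close>; the other order produced
    \<open>f A - f t\<close>.\<close>
  have inner_t: "(\<integral>t. h t s \<partial>lborel) = indicator {0..A} s *\<^sub>R (g s * complex_of_real (sin (x * s))) / complex_of_real x" for s
  proof (cases "s \<in> {0..A}")
    case True
    have "(\<integral>t. h t s \<partial>lborel) = (\<integral>t. g s * (indicator {0..s} t *\<^sub>R complex_of_real (cos (x * t))) \<partial>lborel)"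
      by (rule Bochner_Integration.integral_cong) (use True in \<open>auto simp: h_def indicator_def\<close>)
    also have "\<dots> = g s * (LINT t:{0..s}|lborel. complex_of_real (cos (x * t)))"
      unfolding set_lebesgue_integral_def by (rule integral_mult_right_zero)
    also have "\<dots> = g s * complex_of_real (sin (x * s) / x)"
      using FTC[of s] True by simp
    finally show ?thesis using True by simp
  next
    case False
    then have "h t s = 0" for t by (auto simp: h_def)
    then show ?thesis using False by simp
  qed
  have "(\<integral>s. (\<integral>t. h t s \<partial>lborel) \<partial>lborel) = (\<integral>t. (\<integral>s. h t s \<partial>lborel) \<partial>lborel)"
    by (rule lborel_pair.Fubini_integral[OF pair])
  then have main: "(LINT t:{0..A}|lborel. g t * complex_of_real (sin (x * t))) / complex_of_real x
      = (LINT t:{0..A}|lborel. (f A - f t) * complex_of_real (cos (x * t)))"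
    unfolding inner_s inner_t set_lebesgue_integral_def by simp
  \<comment> \<open>Integrability comes from Fubini: the inner integral of \<open>h\<close> over
    \<open>s\<close> is exactly this function, cut off to \<open>{0..A}\<close>.\<close>
  have i1: "set_integrable lborel {0..A} (\<lambda>t. (f A - f t) * complex_of_real (cos (x * t)))"
    using lborel_pair.integrable_fst[OF pair] unfolding inner_s set_integrable_def by simp
  have i2: "set_integrable lborel {0..A} (\<lambda>t. f A * complex_of_real (cos (x * t)))"
    unfolding set_integrable_def
    by (rule borel_integrable_compact) (auto intro!: continuous_intros)
  \<comment> \<open>Writing \<open>f t\<close> as \<open>f A - (f A - f t)\<close> separates the
    boundary term.\<close>
  have "(LINT t:{0..A}|lborel. f t * complex_of_real (cos (x * t)))
     = (LINT t:{0..A}|lborel. f A * complex_of_real (cos (x * t)) - (f A - f t) * complex_of_real (cos (x * t)))"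
    by (simp add: algebra_simps)
  also have "\<dots> = f A * (LINT t:{0..A}|lborel. complex_of_real (cos (x * t)))
      - (LINT t:{0..A}|lborel. (f A - f t) * complex_of_real (cos (x * t)))"
    by (subst set_integral_diff(2)[OF i2 i1]) simp
  finally show ?thesis using FTC[OF A] main by simp
qed

section \<open>Sine and cosine transforms\<close>

lemma locally_absolutely_continuous_on_imp_continuous_on_Icc:
  assumes "locally_absolutely_continuous_on {0..} f" and "0 \<le> a"
  shows "continuous_on {a..b} f"
  using assms unfolding locally_absolutely_continuous_on_def
  by (intro absolutely_continuous_on_imp_continuous_on) auto

text \<open>The transforms are defined by integrals over \<open>lebesgue\<close>, whereas the Fubini
  and truncation arguments work over \<open>lborel\<close>. This is the bridge for Borel
  integrands.\<close>

lemma set_integral_lebesgue_eq_lborel: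
  fixes h :: "real \<Rightarrow> 'a::{banach, second_countable_topology}"
  assumes "(\<lambda>t. indicator S t *\<^sub>R h t) \<in> borel_measurable borel"
  shows "(LINT t:S|lebesgue. h t) = (LINT t:S|lborel. h t)"
  unfolding set_lebesgue_integral_def by (rule integral_completion) (use assms in simp)

lemma sine_transform_eq_lborel:
  assumes "g \<in> borel_measurable borel"
  shows "sine_transform g x = (LINT t:{0..}|lborel. g t * complex_of_real (sin (x * t)))"
  unfolding sine_transform_def
  by (rule set_integral_lebesgue_eq_lborel) (use assms in measurable)

lemma sine_transform_measurable:
  assumes [measurable]: "g \<in> borel_measurable borel"
  shows "sine_transform g \<in> borel_measurable borel"
proof -
  have "(\<lambda>x. LINT t:{0..}|lborel. g t * complex_of_real (sin (x * t))) \<in> borel_measurable borel"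
    unfolding set_lebesgue_integral_def by measurable
  then show ?thesis by (simp add: sine_transform_eq_lborel[OF assms, abs_def])
qed

lemma tendsto_set_integral_Icc_at_top:
  fixes h :: "real \<Rightarrow> 'a::{banach, second_countable_topology}"
  assumes "set_integrable lborel {a..} h"
  shows "((\<lambda>A. LINT t:{a..A}|lborel. h t) \<longlongrightarrow> (LINT t:{a..}|lborel. h t)) at_top"
proof -
  have eq: "indicator {..A} t *\<^sub>R indicator {a..} t *\<^sub>R h t = indicator {a..A} t *\<^sub>R h t" for A t
    by (auto simp: indicator_def)
  show ?thesis
    using tendsto_integral_at_top[OF _ assms[unfolded set_integrable_def]]
    unfolding set_lebesgue_integral_def eq by simp
qed

text \<open>After integration by parts the boundary term tends to 0, as the sine is bounded and
  \<open>f\<close> tends to 0, while the integral against \<open>g\<close> converges absolutely. The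
  limit therefore exists and \<open>Lim\<close> takes its value.\<close>

lemma cosine_transform_eq_sine_transform:
  fixes f g :: "real \<Rightarrow> complex"
  assumes cont: "\<And>A. continuous_on {0..A} f" and lim: "(f \<longlongrightarrow> 0) at_top"
    and g: "integrable lborel g" and f: "\<And>t. 0 \<le> t \<Longrightarrow> f t - f 0 = (LINT s:{0..t}|lborel. g s)"
    and x: "x > 0"
  shows "cosine_transform f x = - (sine_transform g x / complex_of_real x)"
proof -
  have [measurable]: "g \<in> borel_measurable borel" using g by simp
  have gs: "set_integrable lborel {0..} (\<lambda>t. g t * complex_of_real (sin (x * t)))"
    unfolding set_integrable_def
  proof (rule Bochner_Integration.integrable_bound[OF g])
    show "AE t in lborel. norm (indicator {0..} t *\<^sub>R (g t * complex_of_real (sin (x * t)))) \<le> norm (g t)"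
      by (auto simp: indicator_def norm_mult intro!: mult_left_le)
  qed measurable
  have ev: "\<forall>\<^sub>F A in at_top. f A * complex_of_real (sin (x * A) / x)
      - (LINT t:{0..A}|lborel. g t * complex_of_real (sin (x * t))) / complex_of_real x
      = (LINT t:{0..A}|lebesgue. f t * complex_of_real (cos (x * t)))"
    using eventually_ge_at_top[of 0]
  proof eventually_elim
    case (elim A)
    have "(LINT t:{0..A}|lebesgue. f t * complex_of_real (cos (x * t)))
        = (LINT t:{0..A}|lborel. f t * complex_of_real (cos (x * t)))"
      by (intro set_integral_lebesgue_eq_lborel borel_measurable_continuous_on_indicator
          continuous_intros cont) auto
    then show ?case using cosine_integral_by_parts[OF g elim _ f] x by simp
  qed
  have "((\<lambda>A. f A * complex_of_real (sin (x * A) / x)) \<longlongrightarrow> 0) at_top"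
  proof (rule tendsto_0_le[OF lim, where K="1 / x"])
    have "norm (f A * complex_of_real (sin (x * A) / x)) \<le> norm (f A) * (1 / x)" for A
      unfolding norm_mult norm_of_real using x by (intro mult_left_mono) (auto simp: divide_simps)
    then show "\<forall>\<^sub>F A in at_top. norm (f A * complex_of_real (sin (x * A) / x)) \<le> norm (f A) * (1 / x)"
      by simp
  qed
  then have "((\<lambda>A. f A * complex_of_real (sin (x * A) / x)
      - (LINT t:{0..A}|lborel. g t * complex_of_real (sin (x * t))) / complex_of_real x)
      \<longlongrightarrow> 0 - (LINT t:{0..}|lborel. g t * complex_of_real (sin (x * t))) / complex_of_real x) at_top"
    using x by (intro tendsto_diff tendsto_divide tendsto_set_integral_Icc_at_top gs tendsto_const) auto
  then have "((\<lambda>A. LINT t:{0..A}|lebesgue. f t * complex_of_real (cos (x * t)))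
      \<longlongrightarrow> 0 - (LINT t:{0..}|lborel. g t * complex_of_real (sin (x * t))) / complex_of_real x) at_top"
    by (rule Lim_transform_eventually[OF _ ev])
  from tendsto_Lim[OF _ this] show ?thesis
    by (simp add: cosine_transform_def sine_transform_eq_lborel)
qed

section \<open>Odd extensions and membership in \<open>Q0\<close>\<close>

lemma integrable_odd_extension:
  assumes "integrable lborel g"
  shows "integrable lborel (odd_extension g)"
proof -
  have "integrable lborel (\<lambda>t. g (0 + (- 1) * t))"
    by (rule lborel_integrable_real_affine[OF assms]) simp
  then have "integrable lborel (\<lambda>t. indicator {0<..} t *\<^sub>R g t - indicator {..<0} t *\<^sub>R g (- t))"
    using assms by (intro Bochner_Integration.integrable_diff integrable_mult_indicator) auto
  moreover have "(\<lambda>t. indicator {0<..} t *\<^sub>R g t - indicator {..<0} t *\<^sub>R g (- t)) = odd_extension g"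
    by (auto simp: odd_extension_def indicator_def)
  ultimately show ?thesis by simp
qed

text \<open>\<open>g\<close> is an integrable Borel representative of \<open>h\<close> on the
  half-line. Integrability and oddness of the odd extension then hold automatically, which leaves
  the integral condition.\<close>

lemma belongs_to_Q0_iff:
  assumes g: "integrable lborel g" and N: "negligible N"
    and eq: "\<And>t. t > 0 \<Longrightarrow> t \<notin> N \<Longrightarrow> h t = g t"
  shows "belongs_to_Q0 h \<longleftrightarrow>
    (\<integral>\<^sup>+x\<in>{0<..}. ennreal (norm (sine_transform g x) / x) \<partial>lebesgue) < \<infinity>"
proof -
  have [measurable]: "g \<in> borel_measurable borel" using g by simp
  \<comment> \<open>The odd extensions may also differ on the reflection of \<open>N\<close>, a
    differentiable image of a negligible set.\<close>
  have "negligible (N \<union> uminus ` N)"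
    using N by (intro negligible_Un negligible_differentiable_image_negligible)
      (auto intro!: derivative_intros)
  then have null: "N \<union> uminus ` N \<in> null_sets lebesgue" by (simp add: negligible_iff_null_sets)
  have AE_eq: "AE t in lebesgue. odd_extension g t = odd_extension h t"
  proof (rule AE_I'[OF null], clarsimp)
    fix t assume "odd_extension g t \<noteq> odd_extension h t" "t \<notin> uminus ` N"
    then show "t \<in> N"
      using eq[of t] eq[of "- t"] by (force simp: odd_extension_def image_iff split: if_splits)
  qed
  have int_g: "integrable lebesgue (odd_extension g)"
    using integrable_odd_extension[OF g] integrable_completion[of "odd_extension g" lborel] by auto
  have meas_h: "odd_extension h \<in> borel_measurable lebesgue"
    by (rule borel_measurable_AE[OF borel_measurable_integrable[OF int_g] AE_eq])
  have "integrable lebesgue (odd_extension h)"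
    using integrable_cong_AE_imp[OF int_g meas_h] AE_eq by simp
  moreover have "odd_extension h (- t) = - odd_extension h t" for t
    by (simp add: odd_extension_def)
  moreover have "sine_transform (odd_extension h) x = sine_transform g x" for x
    unfolding sine_transform_def set_lebesgue_integral_def
  proof (rule integral_cong_AE)
    have [measurable]: "(\<lambda>t::real. indicator {0..} t :: real) \<in> borel_measurable lebesgue"
      "(\<lambda>t. complex_of_real (sin (x * t))) \<in> borel_measurable lebesgue"
      "g \<in> borel_measurable lebesgue"
      by (auto intro!: measurable_completion)
    note meas_h[measurable]
    show "(\<lambda>t. indicator {0..} t *\<^sub>R (odd_extension h t * complex_of_real (sin (x * t)))) \<in> borel_measurable lebesgue"
      "(\<lambda>t. indicator {0..} t *\<^sub>R (g t * complex_of_real (sin (x * t)))) \<in> borel_measurable lebesgue"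
      by measurable
    show "AE t in lebesgue. indicator {0..} t *\<^sub>R (odd_extension h t * complex_of_real (sin (x * t)))
        = indicator {0..} t *\<^sub>R (g t * complex_of_real (sin (x * t)))"
      using AE_eq
    proof eventually_elim
      case (elim t)
      \<comment> \<open>At 0 the odd extension is 0 while \<open>g 0\<close> is arbitrary; the
        factor \<open>sin 0\<close> makes both sides vanish.\<close>
      then show ?case by (cases "t = 0") (auto simp: odd_extension_def indicator_def)
    qed
  qed
  ultimately show ?thesis
    unfolding belongs_to_Q0_def Q0_def by simp
qed

theorem theorem2:
  fixes f :: "real \<Rightarrow> complex"
  assumes "locally_absolutely_continuous_on {0..} f"
    and "bounded_variation_on {0..} f"
    and "(f \<longlongrightarrow> 0) at_top"
  shows "set_integrable lebesgue {0..} (cosine_transform f) \<longleftrightarrow>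
         belongs_to_Q0 (\<lambda>t. vector_derivative f (at t))"
proof -
  obtain g where g: "integrable lborel g"
      and fg: "\<And>x. 0 \<le> x \<Longrightarrow> f x - f 0 = (LINT t:{0..x}|lborel. g t)"
    using absolutely_continuous_bounded_variation_density[OF assms(1,2)] by blast
  have [measurable]: "g \<in> borel_measurable borel" using g by simp
  have si: "set_integrable lborel {a..b} g" for a b
    unfolding set_integrable_def using g by (intro integrable_mult_indicator) auto
  obtain N where N: "negligible N"
    "\<And>a x. a < x \<Longrightarrow> x \<notin> N \<Longrightarrow> ((\<lambda>u. integral {a..u} g) has_vector_derivative g x) (at x)"
    using lebesgue_differentiation_real[of g] set_borel_integral_eq_integral(1)[OF si] by blast
  \<comment> \<open>On the open half-line \<open>f\<close> coincides with \<open>f 0\<close> plus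
    the integral of \<open>g\<close> from 0, so Lebesgue differentiation with base point 0
    applies.\<close>
  have deriv: "vector_derivative f (at t) = g t" if t: "t > 0" "t \<notin> N" for t
  proof (rule vector_derivative_at)
    have "((\<lambda>u. f 0 + integral {0..u} g) has_vector_derivative (0 + g t)) (at t)"
      by (intro has_vector_derivative_add has_vector_derivative_const N t)
    moreover have "f 0 + integral {0..u} g = f u" if "u \<in> {0<..}" for u
      using fg[of u] set_borel_integral_eq_integral(2)[OF si] that by (simp add: algebra_simps)
    ultimately show "(f has_vector_derivative g t) (at t)"
      using has_vector_derivative_transform_within_open[of _ "0 + g t" t "{0<..}" f] t by simp
  qed
  \<comment> \<open>\<open>H\<close> is a Borel version of the cosine transform on the half-line. It
    is 0 at the point 0, where the improper integral may diverge.\<close>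
  define H where "H x = indicator {0<..} x *\<^sub>R (- (sine_transform g x / complex_of_real x))" for x :: real
  have cos: "cosine_transform f x = - (sine_transform g x / complex_of_real x)" if "x > 0" for x
    by (rule cosine_transform_eq_sine_transform[OF _ assms(3) g fg that])
      (rule locally_absolutely_continuous_on_imp_continuous_on_Icc[OF assms(1)], simp_all)
  have Hb: "H \<in> borel_measurable borel"
    unfolding H_def using sine_transform_measurable[of g] by measurable
  then have Hm: "H \<in> borel_measurable lebesgue" by (simp add: measurable_completion)
  have AE_eq: "AE x in lebesgue. H x = indicator {0..} x *\<^sub>R cosine_transform f x"
  proof -
    have "AE x in lebesgue. x \<noteq> (0::real)" by (rule AE_completion) (rule AE_lborel_singleton)
    then show ?thesis
      by eventually_elim (auto simp: H_def cos indicator_def)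
  qed
  \<comment> \<open>Measurability of the cosine transform is inherited from \<open>H\<close> through
    completeness of \<open>lebesgue\<close>.\<close>
  have "set_integrable lebesgue {0..} (cosine_transform f) \<longleftrightarrow> integrable lebesgue H"
    unfolding set_integrable_def
    by (rule integrable_cong_AE[OF borel_measurable_AE[OF Hm AE_eq] Hm])
      (use AE_eq in eventually_elim, simp)
  also have "\<dots> \<longleftrightarrow> (\<integral>\<^sup>+x. ennreal (norm (H x)) \<partial>lebesgue) < \<infinity>"
    using Hm by (simp add: integrable_iff_bounded)
  also have "(\<integral>\<^sup>+x. ennreal (norm (H x)) \<partial>lebesgue)
      = (\<integral>\<^sup>+x\<in>{0<..}. ennreal (norm (sine_transform g x) / x) \<partial>lebesgue)"
    by (rule nn_integral_cong) (auto simp: H_def indicator_def norm_divide)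
  also have "\<dots> < \<infinity> \<longleftrightarrow> belongs_to_Q0 (\<lambda>t. vector_derivative f (at t))"
    by (rule belongs_to_Q0_iff[OF g N(1) deriv, symmetric])
  finally show ?thesis .
qed

end
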